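(* Let $r\ge 2$, let $a_1,\dots,a_r,b_1,\dots,b_r\in\mathbb C$ with $b_r=1$, and assume that $b_1,\dots,b_r$ are pairwise distinct modulo $\mathbb Z$. Set $$c_i:=\prod_{\substack{1\le j\le r\\ j\ne i}}\frac{1}{b_j-b_i},\qquad i=1,\dots,r.$$ Let $f_i(z)$, $g_i(z)$ ($1\le i\le r$) be the solutions of the hypergeometric equation and of its dual, as defined in the context, let $\theta=z\frac{d}{dz}$, and let $H$ be the field generated over $\mathbb Q$ by the $a_i,b_j$. Then for any $k,l=0,1,\dots,r-1$, $$\sum_{i=1}^r c_i\,\theta^k(f_i)(z)\,\theta^l(g_i)(z)=:M_{kl}\in H(z).$$ In particular, $M_{kl}=0$ if $k+l\le r-2$, and $M_{kl}=\dfrac{(-1)^{k}}{1-z}$ if $k+l=r-1$.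
   Context: $(x)_0:=1$ and $(x)_n:=x(x+1)\cdots(x+n-1)$ for $n\ge1$. The hypergeometric equation of order $r$ is $(\theta+b_1-1)\cdots(\theta+b_r-1)f=z(\theta+a_1)\cdots(\theta+a_r)f$, and its dual is $(\theta-b_1+1)\cdots(\theta-b_r+1)g=z(\theta-a_1+1)\cdots(\theta-a_r+1)g$. For $1\le i\le r$, $$f_i(z):=z^{1-b_i}\sum_{n\ge0}\frac{\prod_{j=1}^r(a_j+1-b_i)_n}{\prod_{j=1}^r(b_j+1-b_i)_n}z^n,\qquad g_i(z):=z^{b_i-1}\sum_{n\ge0}\frac{\prod_{j=1}^r(b_i-a_j)_n}{\prod_{j=1}^r(b_i+1-b_j)_n}z^n$$ (the factor $j=i$ in each denominator equals $n!$). That is, $f_i=z^{1-b_i}\,{}_rF_{r-1}$ with upper parameters $a_j+1-b_i$ ($1\le j\le r$) and lower parameters $b_j+1-b_i$ ($j\ne i$), and $g_i=z^{b_i-1}\,{}_rF_{r-1}$ with upper parameters $b_i-a_j$ ($1\le j\le r$) and lower parameters $b_i+1-b_j$ ($j\neq i$), both evaluated at $z$. The powers $z^s$ are non-trivial solutions of $\theta(f)=sf$ with $z^sz^t=z^{s+t}$, so each product $\theta^k(f_i)\theta^l(g_i)$ is a power series in $z$; membership in $H(z)$ means that the sum is the expansion at $z=0$ of a rational function with coefficients in $H$.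
   Formalization: For k+l=r-1 the formal value is M_{kl}=(-1)^l/(1-z) instead of (-1)^k/(1-z); with the given c_i the printed sign is false for even r (r=2, k=0, l=1 gives constant term c_1(b_1-1)=-1), and the two signs agree for odd r. *)

theory Defs
  imports "HOL-Library.Poly_Mapping" "HOL-Computational_Algebra.Computational_Algebra"
begin

text \<open>
  The functions \<open>z\<^sup>s F(z)\<close> with complex \<open>s\<close> and \<open>F\<close> a power series live in the group ring
  of \<open>(\<complex>, +)\<close> over the ring of power series: \<open>single s F\<close> stands for \<open>z\<^sup>s F(z)\<close>, and the
  ring product of the library gives \<open>z\<^sup>s z\<^sup>t = z\<^sup>s\<^sup>+\<^sup>t\<close>. This is the universal commutative extension
  of the power series by symbols \<open>z\<^sup>s\<close> with \<open>z\<^sup>0 = 1\<close>, \<open>z\<^sup>s z\<^sup>t = z\<^sup>s\<^sup>+\<^sup>t\<close> and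
  \<open>\<theta>(z\<^sup>s) = s z\<^sup>s\<close>. It does not identify the symbol \<open>z\<^sup>1\<close> with the series \<open>fps_X\<close>,
  so an identity proved here remains valid in every such extension, including those that
  make this identification. The power series are embedded as \<open>single 0 F\<close>.
\<close>

type_synonym zseries = "complex \<Rightarrow>\<^sub>0 complex fps"

definition fps_embed :: "complex fps \<Rightarrow> zseries" where
  "fps_embed F = Poly_Mapping.single 0 F"

definition zpow :: "complex \<Rightarrow> zseries" where
  "zpow s = Poly_Mapping.single s 1"

text \<open>\<open>\<theta> = z d/dz\<close>, that is, \<open>\<theta>(z\<^sup>s F) = z\<^sup>s (s F + z F')\<close>.\<close>

definition theta :: "zseries \<Rightarrow> zseries" where
  "theta = Poly_Mapping.mapp (\<lambda>s F. fps_const s * F + fps_X * fps_deriv F)"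

definition hyp_f :: "nat \<Rightarrow> (nat \<Rightarrow> complex) \<Rightarrow> (nat \<Rightarrow> complex) \<Rightarrow> nat \<Rightarrow> zseries" where
  "hyp_f r a b i = zpow (1 - b i) * fps_embed (Abs_fps (\<lambda>n.
     (\<Prod>j=1..r. pochhammer (a j + 1 - b i) n) / (\<Prod>j=1..r. pochhammer (b j + 1 - b i) n)))"

definition hyp_g :: "nat \<Rightarrow> (nat \<Rightarrow> complex) \<Rightarrow> (nat \<Rightarrow> complex) \<Rightarrow> nat \<Rightarrow> zseries" where
  "hyp_g r a b i = zpow (b i - 1) * fps_embed (Abs_fps (\<lambda>n.
     (\<Prod>j=1..r. pochhammer (b i - a j) n) / (\<Prod>j=1..r. pochhammer (b i + 1 - b j) n)))"

definition dual_coeff :: "nat \<Rightarrow> (nat \<Rightarrow> complex) \<Rightarrow> nat \<Rightarrow> complex" where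
  "dual_coeff r b i = (\<Prod>j\<in>{1..r} - {i}. 1 / (b j - b i))"

text \<open>Closure under \<open>inverse\<close> may include \<open>0\<close>, since \<open>inverse 0 = 0\<close>.\<close>

definition is_subfield :: "complex set \<Rightarrow> bool" where
  "is_subfield K \<longleftrightarrow> 1 \<in> K \<and> (\<forall>x\<in>K. \<forall>y\<in>K. x - y \<in> K \<and> x * y \<in> K) \<and> (\<forall>x\<in>K. inverse x \<in> K)"

text \<open>A subfield of the complex numbers contains the rationals, so this is the field that
  the parameters generate over the rationals.\<close>

definition param_field :: "nat \<Rightarrow> (nat \<Rightarrow> complex) \<Rightarrow> (nat \<Rightarrow> complex) \<Rightarrow> complex set" where
  "param_field r a b = is_subfield hull (a ` {1..r} \<union> b ` {1..r})"

text \<open>Expansions at \<open>z = 0\<close> of the rational functions \<open>P / Q\<close> with coefficients in \<open>K\<close>.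
  The equation is cross-multiplied because \<open>Q\<close> may vanish at \<open>0\<close>, and then division of
  power series truncates.\<close>

definition rational_expansions :: "complex set \<Rightarrow> complex fps set" where
  "rational_expansions K =
     {F. \<exists>P Q. (\<forall>n. coeff P n \<in> K) \<and> (\<forall>n. coeff Q n \<in> K) \<and> Q \<noteq> 0 \<and>
               fps_of_poly Q * F = fps_of_poly P}"

lemma theta_single:
  "theta (Poly_Mapping.single s F) =
     Poly_Mapping.single s (fps_const s * F + fps_X * fps_deriv F)"
  by (rule poly_mapping_eqI)
    (auto simp: theta_def mapp.rep_eq lookup_single when_def split: if_splits)

lemma theta_zpow: "theta (zpow s) = fps_embed (fps_const s) * zpow s"
  by (simp add: zpow_def fps_embed_def theta_single mult_single)

lemma zpow_add: "zpow (s + t) = zpow s * zpow t"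
  by (simp add: zpow_def mult_single)

lemma theta_fps_embed: "theta (fps_embed F) = fps_embed (fps_X * fps_deriv F)"
  by (simp add: fps_embed_def theta_single)

lemma theta_add: "theta (p + q) = theta p + theta q"
proof (rule poly_mapping_eqI)
  have L: "Poly_Mapping.lookup (theta p) s =
      fps_const s * Poly_Mapping.lookup p s + fps_X * fps_deriv (Poly_Mapping.lookup p s)" for p s
    by (simp add: theta_def mapp.rep_eq in_keys_iff when_def)
  show "Poly_Mapping.lookup (theta (p + q)) s = Poly_Mapping.lookup (theta p + theta q) s" for s
    by (simp add: L lookup_add algebra_simps)
qed

lemma zseries_induct:
  fixes p :: zseries
  assumes "P 0" and "\<And>s F p. P p \<Longrightarrow> P (Poly_Mapping.single s F + p)"
  shows "P p"
proof (induction p rule: update_induct)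
  case const
  show ?case by (rule assms(1))
next
  case (update f a b)
  have "Poly_Mapping.update a b f = Poly_Mapping.single a b + f"
    using update(1)
    by (intro poly_mapping_eqI) (auto simp: lookup_update lookup_add lookup_single in_keys_iff when_def)
  then show ?case using assms(2) update by simp
qed

lemma theta_mult: "theta (p * q) = theta p * q + p * theta q"
proof -
  have single: "theta (Poly_Mapping.single s F * Poly_Mapping.single t G) =
      theta (Poly_Mapping.single s F) * Poly_Mapping.single t G +
      Poly_Mapping.single s F * theta (Poly_Mapping.single t G)" for s t F G
    by (simp add: mult_single theta_single flip: single_add)
       (simp add: algebra_simps flip: fps_const_add)
  have zero: "theta 0 = 0"
    using theta_add[of 0 0] by simp
  have left: "theta (Poly_Mapping.single s F * q) =
      theta (Poly_Mapping.single s F) * q + Poly_Mapping.single s F * theta q" for s F q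
    by (induction q rule: zseries_induct)
       (simp_all add: zero theta_add single distrib_left distrib_right add_ac)
  show ?thesis
    by (induction p rule: zseries_induct)
       (simp_all add: zero theta_add left distrib_left distrib_right add_ac)
qed

text \<open>The next lemma settles the sign in the case \<open>k + l = r - 1\<close>. At \<open>z = 0\<close> the sum is
  \<open>\<Sum>\<^sub>i c\<^sub>i (1 - b\<^sub>i)\<^sup>k (b\<^sub>i - 1)\<^sup>l = (-1)\<^sup>k (-1)\<^sup>r\<^sup>-\<^sup>1 = (-1)\<^sup>l\<close>, because
  \<open>\<Sum>\<^sub>i x\<^sub>i\<^sup>r\<^sup>-\<^sup>1 / \<Prod>\<^sub>j\<^sub>\<noteq>\<^sub>i (x\<^sub>i - x\<^sub>j) = 1\<close>, while \<open>c\<^sub>i\<close> is built from \<open>b\<^sub>j - b\<^sub>i\<close>.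
  This equals \<open>(-1)\<^sup>k\<close> only for odd \<open>r\<close>: for \<open>r = 2\<close>, \<open>k = 0\<close>, \<open>l = 1\<close>
  the constant term is \<open>-1\<close>.\<close>

lemma sign_for_order_two:
  fixes a b :: "nat \<Rightarrow> complex"
  assumes "b 2 = 1" and "b 1 - b 2 \<notin> \<int>"
    and "(\<Sum>i=1..2. fps_embed (fps_const (dual_coeff 2 b i)) *
            hyp_f 2 a b i * theta (hyp_g 2 a b i)) = fps_embed M"
  shows "fps_nth M 0 = -1"
proof -
  have ne: "b 1 \<noteq> 1" using assms by auto
  have "{Suc 0..2} - {Suc 0} = {2}" "{Suc 0..2} - {2} = {Suc 0}" by auto
  then have c: "dual_coeff 2 b 1 = 1 / (b 2 - b 1)" "dual_coeff 2 b 2 = 1 / (b 1 - b 2)"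
    by (simp_all add: dual_coeff_def)
  have I: "{1..2::nat} = {1, 2}" by auto
  have "fps_nth (Poly_Mapping.lookup (\<Sum>i=1..2. fps_embed (fps_const (dual_coeff 2 b i)) *
            hyp_f 2 a b i * theta (hyp_g 2 a b i)) 0) 0 = -1"
    unfolding I using ne assms(1)
    by (simp add: c[simplified] hyp_f_def hyp_g_def zpow_def fps_embed_def mult_single
          theta_single lookup_add lookup_single divide_simps)
  then show ?thesis
    unfolding assms(3) by (simp add: fps_embed_def)
qed

end

theory Submission
  imports Defs
begin

text \<open>
  Each coefficient of the bilinear sum is a sum of residues. Put \<open>s = m + 1 - b\<^sub>i\<close>. In the product
  of the \<open>m\<close>-th coefficient of \<open>f\<^sub>i\<close> with the \<open>(N - m)\<close>-th coefficient of \<open>g\<^sub>i\<close> the Pochhammer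
  symbols combine into products over \<open>N\<close> consecutive shifts in the numerator, and over
  \<open>N + 1\<close> shifts with the one for \<open>u = m\<close> left out in the denominator; \<open>c\<^sub>i\<close> supplies the
  missing factors \<open>b\<^sub>j - b\<^sub>i\<close> for \<open>j \<noteq> i\<close>. Hence this product, times \<open>c\<^sub>i\<close>, is the residue
  at \<open>s\<close> of
  \<open>R\<^sub>N(x) = \<Prod>\<^sub>j (\<Prod>\<^sub>t (x + a\<^sub>j - 1 - t) / \<Prod>\<^sub>u (x + b\<^sub>j - 1 - u))\<close>,
  where \<open>1 \<le> j \<le> r\<close>, \<open>0 \<le> t < N\<close> and \<open>0 \<le> u \<le> N\<close> (\<open>hyp_coeff_eq_node_weight\<close>).
  The poles of \<open>R\<^sub>N\<close> lie among the nodes \<open>m + 1 - b\<^sub>i\<close> with \<open>m \<le> N\<close>, which are distinct because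
  the \<open>b\<^sub>i\<close> are distinct modulo the integers. The operators
  \<open>\<theta>\<^sup>k\<close> and \<open>\<theta>\<^sup>l\<close> contribute the factors \<open>s\<^sup>k\<close> and \<open>(N - s)\<^sup>l\<close>. The coefficient of
  \<open>z\<^sup>N\<close> in the bilinear sum is therefore the sum of all residues of \<open>x\<^sup>k (N - x)\<^sup>l R\<^sub>N(x)\<close>,
  that is, the coefficient of \<open>1/x\<close> in the expansion of this function at infinity. In terms
  of \<open>X = 1/x\<close> it is the coefficient of \<open>X\<^sup>k\<^sup>+\<^sup>l\<^sup>-\<^sup>(\<^sup>r\<^sup>-\<^sup>1\<^sup>)\<close> in a power series with
  constant term \<open>(-1)\<^sup>l\<close>, and it is zero if the exponent is negative
  (\<open>bilinear_sum_coeff\<close>, by \<open>sum_node_weight_geom\<close>). This gives the two special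
  cases.

  For rationality it suffices that, for a fixed exponent of \<open>X\<close>, this coefficient depends
  polynomially on \<open>N\<close>, in the sense of Newton's forward differences with values in the
  parameter field (\<open>node_fps_poly_fps_seq\<close>). The generating function of such a sequence is
  rational, with a power of \<open>1 - z\<close> as denominator (\<open>poly_seq_rational_expansion\<close>).
\<close>

section \<open>Polynomial sequences over a subring\<close>

text \<open>A subset closed under the operations of a commutative ring with one. No division is
  needed below.\<close>

locale subring =
  fixes K :: "'a::comm_ring_1 set"
  assumes one_mem: "1 \<in> K"
    and diff_mem: "x \<in> K \<Longrightarrow> y \<in> K \<Longrightarrow> x - y \<in> K"
    and mult_mem: "x \<in> K \<Longrightarrow> y \<in> K \<Longrightarrow> x * y \<in> K"
begin

lemma zero_mem: "0 \<in> K"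
  using diff_mem[OF one_mem one_mem] by simp

lemma uminus_mem: "x \<in> K \<Longrightarrow> - x \<in> K"
  using diff_mem[OF zero_mem] by simp

lemma add_mem: "x \<in> K \<Longrightarrow> y \<in> K \<Longrightarrow> x + y \<in> K"
  using diff_mem[of x "- y"] uminus_mem by simp

text \<open>The sequences that some iterated forward difference annihilates and whose initial
  differences all lie in \<open>K\<close>: the \<open>K\<close>-linear combinations of the sequences
  \<open>n choose d\<close>. In this form, summation preserves the class by definition.\<close>

inductive_set poly_seqs :: "(nat \<Rightarrow> 'a) set" where
  zero: "(\<lambda>_. 0) \<in> poly_seqs"
| step: "f 0 \<in> K \<Longrightarrow> (\<lambda>n. f (Suc n) - f n) \<in> poly_seqs \<Longrightarrow> f \<in> poly_seqs"

lemma poly_seq_0_mem: "f \<in> poly_seqs \<Longrightarrow> f 0 \<in> K"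
  by (cases rule: poly_seqs.cases) (auto simp: zero_mem)

lemma const_poly_seq: "c \<in> K \<Longrightarrow> (\<lambda>_. c) \<in> poly_seqs"
  by (rule poly_seqs.step) (simp_all add: poly_seqs.zero)

lemma of_nat_poly_seq: "(\<lambda>n. of_nat n) \<in> poly_seqs"
  by (rule poly_seqs.step) (simp_all add: zero_mem const_poly_seq one_mem)

lemma add_poly_seq:
  assumes "f \<in> poly_seqs" "g \<in> poly_seqs"
  shows "(\<lambda>n. f n + g n) \<in> poly_seqs"
  using assms
proof (induction f arbitrary: g rule: poly_seqs.induct)
  case (step f)
  from step.prems show ?case
  proof cases
    case zero
    then show ?thesis using poly_seqs.step[OF step.hyps] by simp
  next
    case step': step
    have "(\<lambda>n. (f (Suc n) - f n) + (g (Suc n) - g n)) \<in> poly_seqs"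
      by (rule step.IH[OF step'(2)])
    moreover have "f 0 + g 0 \<in> K"
      by (intro add_mem step.hyps step')
    ultimately show ?thesis
      using poly_seqs.step[of "\<lambda>n. f n + g n"] by (simp add: algebra_simps)
  qed
qed simp

lemma mult_poly_seq:
  assumes "f \<in> poly_seqs" "g \<in> poly_seqs"
  shows "(\<lambda>n. f n * g n) \<in> poly_seqs"
  using assms
proof (induction f arbitrary: g rule: poly_seqs.induct)
  case zero
  show ?case by (simp add: poly_seqs.zero)
next
  case (step f)
  let ?df = "\<lambda>n. f (Suc n) - f n"
  from step.prems show ?case
  proof (induction g rule: poly_seqs.induct)
    case zero
    show ?case by (simp add: poly_seqs.zero)
  next
    case g: (step g)
    let ?dg = "\<lambda>n. g (Suc n) - g n"
    \<comment> \<open>The discrete Leibniz rule. The first two products fall under the induction hypothesis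
      on \<open>f\<close>, which holds for every second factor, the last one under that on \<open>g\<close>.\<close>
    have "(\<lambda>n. (?df n * g n + ?df n * ?dg n) + f n * ?dg n) \<in> poly_seqs"
      by (intro add_poly_seq step.IH g.IH g.hyps poly_seqs.step[OF g.hyps])
    moreover have "f 0 * g 0 \<in> K"
      by (intro mult_mem step.hyps g.hyps)
    ultimately show ?case
      using poly_seqs.step[of "\<lambda>n. f n * g n"] by (simp add: algebra_simps)
  qed
qed

lemma power_poly_seq: "f \<in> poly_seqs \<Longrightarrow> (\<lambda>n. f n ^ m) \<in> poly_seqs"
  by (induction m) (simp_all add: const_poly_seq one_mem mult_poly_seq)

lemma sum_poly_seq:
  "(\<And>i. i \<in> I \<Longrightarrow> f i \<in> poly_seqs) \<Longrightarrow> (\<lambda>n. \<Sum>i\<in>I. f i n) \<in> poly_seqs"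
  by (induction I rule: infinite_finite_induct) (auto simp: poly_seqs.zero add_poly_seq)

text \<open>Sequences of power series each of whose coefficients is a polynomial sequence. The
  degree may grow with the position of the coefficient.\<close>

definition poly_fps_seqs :: "(nat \<Rightarrow> 'a fps) set" where
  "poly_fps_seqs = {U. \<forall>p. (\<lambda>N. fps_nth (U N) p) \<in> poly_seqs}"

lemma mult_poly_fps_seq:
  assumes "U \<in> poly_fps_seqs" "V \<in> poly_fps_seqs"
  shows "(\<lambda>N. U N * V N) \<in> poly_fps_seqs"
  using assms unfolding poly_fps_seqs_def
  by (auto simp: fps_mult_nth intro!: sum_poly_seq mult_poly_seq)

lemma one_poly_fps_seq: "(\<lambda>_. 1) \<in> poly_fps_seqs"
  by (auto simp: poly_fps_seqs_def zero_mem one_mem intro!: const_poly_seq)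

lemma prod_poly_fps_seq:
  "(\<And>i. i \<in> I \<Longrightarrow> U i \<in> poly_fps_seqs) \<Longrightarrow> (\<lambda>N. \<Prod>i\<in>I. U i N) \<in> poly_fps_seqs"
  by (induction I rule: infinite_finite_induct) (auto simp: one_poly_fps_seq mult_poly_fps_seq)

lemma power_poly_fps_seq: "U \<in> poly_fps_seqs \<Longrightarrow> (\<lambda>N. U N ^ m) \<in> poly_fps_seqs"
  by (induction m) (simp_all add: one_poly_fps_seq mult_poly_fps_seq)

lemma linear_poly_fps_seq:
  assumes "c \<in> K" "f \<in> poly_seqs"
  shows "(\<lambda>N. fps_const c + fps_const (f N) * fps_X) \<in> poly_fps_seqs"
  unfolding poly_fps_seqs_def
proof safe
  fix p :: nat
  consider "p = 0" | "p = 1" | "p > 1" by linarith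
  then show "(\<lambda>N. (fps_const c + fps_const (f N) * fps_X) $ p) \<in> poly_seqs"
    by cases (use assms in \<open>simp_all add: const_poly_seq zero_mem\<close>)
qed

text \<open>As the factors have constant term 1, the forward difference of the \<open>p\<close>-th coefficient
  involves only the coefficients of \<open>U\<close> below \<open>p\<close>, so that strong induction on \<open>p\<close> applies.\<close>

lemma partial_product_poly_fps_seq:
  assumes V: "V \<in> poly_fps_seqs" and V0: "\<And>N. fps_nth (V N) 0 = 1"
    and U0: "\<And>p. fps_nth (U 0) p \<in> K" and rec: "\<And>N. U (Suc N) = U N * V N"
  shows "U \<in> poly_fps_seqs"
  unfolding poly_fps_seqs_def
proof safe
  fix p
  show "(\<lambda>N. fps_nth (U N) p) \<in> poly_seqs"
  proof (induction p rule: less_induct)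
    case (less p)
    have "fps_nth (U (Suc N)) p - fps_nth (U N) p
        = (\<Sum>q<p. fps_nth (U N) q * fps_nth (V N) (p - q))" for N
      unfolding rec fps_mult_nth atLeast0AtMost by (simp add: V0 flip: lessThan_Suc_atMost)
    moreover have "(\<lambda>N. \<Sum>q<p. fps_nth (U N) q * fps_nth (V N) (p - q)) \<in> poly_seqs"
      using V by (intro sum_poly_seq mult_poly_seq less) (auto simp: poly_fps_seqs_def)
    ultimately show ?case
      using poly_seqs.step[of "\<lambda>N. fps_nth (U N) p"] by (simp add: U0)
  qed
qed

end

text \<open>If \<open>F\<close> and \<open>D\<close> are the generating functions of \<open>f\<close> and of its forward difference,
  then \<open>(1 - z) F = f(0) + z D\<close>.\<close>

lemma poly_seq_rational_expansion:
  assumes "subring K" and "f \<in> subring.poly_seqs K"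
  shows "Abs_fps f \<in> rational_expansions K"
proof -
  interpret subring K by fact
  from assms(2) show ?thesis
  proof (induction f rule: poly_seqs.induct)
    case zero
    have "fps_of_poly 1 * Abs_fps (\<lambda>_. 0) = fps_of_poly (0 :: complex poly)"
      by (simp add: fps_eq_iff)
    then show ?case
      unfolding rational_expansions_def mem_Collect_eq
      by (intro exI[of _ "0 :: complex poly"] exI[of _ "1 :: complex poly"])
        (simp add: zero_mem one_mem coeff_1)
  next
    case (step f)
    let ?d = "Abs_fps (\<lambda>n. f (Suc n) - f n)"
    from step.IH obtain P Q where PQ: "\<And>n. coeff P n \<in> K" "\<And>n. coeff Q n \<in> K" "Q \<noteq> 0"
      "fps_of_poly Q * ?d = fps_of_poly P"
      unfolding rational_expansions_def by blast
    have F: "(1 - fps_X) * Abs_fps f = fps_const (f 0) + fps_X * ?d"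
    proof (rule fps_ext)
      show "((1 - fps_X) * Abs_fps f) $ n = (fps_const (f 0) + fps_X * ?d) $ n" for n
        by (cases n) (simp_all add: left_diff_distrib)
    qed
    have "fps_of_poly (Q * [:1, -1:]) * Abs_fps f
        = fps_of_poly Q * ((1 - fps_X) * Abs_fps f)"
      by (simp add: fps_of_poly_mult fps_of_poly_pCons mult.assoc)
    also have "\<dots> = fps_of_poly (smult (f 0) Q + pCons 0 P)"
      unfolding F by (simp add: PQ(4)[symmetric] fps_of_poly_add fps_of_poly_smult
          fps_of_poly_pCons algebra_simps)
    finally have "fps_of_poly (Q * [:1, -1:]) * Abs_fps f
        = fps_of_poly (smult (f 0) Q + pCons 0 P)" .
    moreover have "coeff (Q * [:1, -1:]) n \<in> K" "coeff (smult (f 0) Q + pCons 0 P) n \<in> K" for n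
      using PQ(1,2) step.hyps(1)
      by (auto simp: coeff_pCons zero_mem split: nat.split intro!: add_mem mult_mem diff_mem uminus_mem)
    moreover have "Q * [:1, -1:] \<noteq> 0"
      using PQ(3) by (simp only: mult_eq_0_iff) simp
    ultimately show ?case
      unfolding rational_expansions_def by blast
  qed
qed

section \<open>Weighted sums over distinct nodes\<close>

text \<open>The geometric series \<open>1 / (1 - c X)\<close>.\<close>

definition geom_fps :: "'a::comm_ring_1 \<Rightarrow> 'a fps" where
  "geom_fps c = Abs_fps (\<lambda>n. c ^ n)"

lemma geom_fps_nth [simp]: "fps_nth (geom_fps c) n = c ^ n"
  by (simp add: geom_fps_def)

lemma geom_fps_inverse: "(1 - fps_const c * fps_X) * geom_fps c = 1"
proof (rule fps_ext)
  show "((1 - fps_const c * fps_X) * geom_fps c) $ n = 1 $ n" for n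
    by (cases n) (simp_all add: left_diff_distrib mult.assoc)
qed

lemma (in subring) geom_poly_fps_seq:
  "f \<in> poly_seqs \<Longrightarrow> (\<lambda>N. geom_fps (f N)) \<in> poly_fps_seqs"
  by (simp add: poly_fps_seqs_def power_poly_seq)

text \<open>The residue at \<open>x\<^sub>i\<close> of the reciprocal of \<open>\<Prod>\<^sub>j (X - x\<^sub>j)\<close>, for distinct nodes
  \<open>x\<^sub>j\<close> indexed by \<open>I\<close>.\<close>

definition node_weight :: "'i set \<Rightarrow> ('i \<Rightarrow> 'a::field) \<Rightarrow> 'i \<Rightarrow> 'a" where
  "node_weight I x i = (\<Prod>j\<in>I - {i}. 1 / (x i - x j))"

lemma node_weight_remove:
  assumes "finite I" "inj_on x I" "i \<in> I" "j \<in> I" "i \<noteq> j"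
  shows "node_weight (I - {j}) x i = node_weight I x i * (x i - x j)"
proof -
  have "x i - x j \<noteq> 0" using assms by (auto dest: inj_onD)
  moreover have "I - {i} = insert j (I - {j} - {i})" using assms by auto
  ultimately show ?thesis
    using assms(1) by (simp add: node_weight_def)
qed

lemma sum_node_weight_remove:
  fixes f :: "'i \<Rightarrow> 'a::field fps"
  assumes "finite I" "inj_on x I" "j \<in> I"
  shows "(\<Sum>i\<in>I - {j}. fps_const (node_weight (I - {j}) x i) * f i)
    = (\<Sum>i\<in>I. fps_const (node_weight I x i * (x i - x j)) * f i)"
proof -
  have "(\<Sum>i\<in>I. fps_const (node_weight I x i * (x i - x j)) * f i)
      = (\<Sum>i\<in>I - {j}. fps_const (node_weight I x i * (x i - x j)) * f i)"
    using assms by (subst sum.remove[of I j]) auto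
  also have "\<dots> = (\<Sum>i\<in>I - {j}. fps_const (node_weight (I - {j}) x i) * f i)"
    using assms by (intro sum.cong) (auto simp: node_weight_remove)
  finally show ?thesis by simp
qed

text \<open>The partial fraction decomposition of \<open>\<Prod>\<^sub>i 1 / (y - x\<^sub>i)\<close>, written in \<open>X = 1/y\<close>
  and divided by \<open>X\<close>. Both sides, as functions of the set of nodes, satisfy the recursion of
  divided differences
  \<open>(x\<^sub>\<alpha> - x\<^sub>\<beta>) S(I) = S(I - {\<beta>}) - S(I - {\<alpha>})\<close>.\<close>

lemma sum_node_weight_geom:
  fixes x :: "'i \<Rightarrow> 'a::field"
  assumes "finite I" "I \<noteq> {}" "inj_on x I"
  shows "(\<Sum>i\<in>I. fps_const (node_weight I x i) * geom_fps (x i))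
    = fps_X ^ (card I - 1) * (\<Prod>i\<in>I. geom_fps (x i))"
  using assms
proof (induction "card I" arbitrary: I rule: less_induct)
  case less
  note fin = less.prems(1) and inj = less.prems(3)
  show ?case
  proof (cases "\<exists>\<alpha>\<in>I. \<exists>\<beta>\<in>I. \<alpha> \<noteq> \<beta>")
    case False
    with less.prems obtain i where "I = {i}" by blast
    then show ?thesis by (simp add: node_weight_def)
  next
    case True
    then obtain \<alpha> \<beta> where ab: "\<alpha> \<in> I" "\<beta> \<in> I" "\<alpha> \<noteq> \<beta>" by blast
    define S where "S J = (\<Sum>i\<in>J. fps_const (node_weight J x i) * geom_fps (x i))" for J
    define R where "R J = fps_X ^ (card J - 1) * (\<Prod>i\<in>J. geom_fps (x i))" for J
    have "card {\<alpha>, \<beta>} \<le> card I"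
      using ab fin by (intro card_mono) auto
    then have cI: "card I \<ge> 2" using ab by simp
    then obtain d where d: "card I = Suc (Suc d)"
      by (metis Suc_diff_Suc numeral_2_eq_2 Suc_le_eq less_imp_Suc_add add_Suc)
    have IH: "S (I - {j}) = R (I - {j})" if "j \<in> I" for j
      unfolding S_def R_def
    proof (rule less.hyps)
      show "card (I - {j}) < card I" using that fin by (meson card_Diff1_less)
      show "I - {j} \<noteq> {}" using ab by auto
    qed (use fin inj in \<open>auto intro: inj_on_subset\<close>)
    have removed: "R (I - {j})
        = fps_X ^ d * (1 - fps_const (x j) * fps_X) * (\<Prod>i\<in>I. geom_fps (x i))" if "j \<in> I" for j
    proof -
      have "(\<Prod>i\<in>I - {j}. geom_fps (x i))
          = ((1 - fps_const (x j) * fps_X) * geom_fps (x j)) * (\<Prod>i\<in>I - {j}. geom_fps (x i))"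
        by (simp add: geom_fps_inverse)
      also have "\<dots> = (1 - fps_const (x j) * fps_X) * (\<Prod>i\<in>I. geom_fps (x i))"
        by (simp add: prod.remove[OF fin that] mult.assoc)
      finally show ?thesis
        using that fin d by (simp add: R_def mult.assoc)
    qed
    have ne: "x \<alpha> - x \<beta> \<noteq> 0" using ab inj by (auto dest: inj_onD)
    have "fps_const (x \<alpha> - x \<beta>) * S I = S (I - {\<beta>}) - S (I - {\<alpha>})"
      unfolding S_def sum_node_weight_remove[OF fin inj ab(1)]
        sum_node_weight_remove[OF fin inj ab(2)] sum_distrib_left sum_subtractf[symmetric]
      by (intro sum.cong refl)
        (simp add: algebra_simps flip: fps_const_mult fps_const_sub)
    also have "\<dots> = R (I - {\<beta>}) - R (I - {\<alpha>})"
      using ab by (simp add: IH)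
    also have "\<dots> = fps_const (x \<alpha> - x \<beta>) * R I"
      using ab by (simp add: removed) (simp add: R_def d algebra_simps flip: fps_const_sub)
    finally have "S I = R I"
      using ne by simp
    then show ?thesis by (simp add: S_def R_def)
  qed
qed

text \<open>From the coefficient at position \<open>e\<close> on, \<open>B\<close> is the geometric sequence
  \<open>p, p s, p s\<^sup>2, \<dots>\<close>. If \<open>A\<close> is the reversal \<open>X\<^sup>e P(1/X)\<close> of a polynomial \<open>P\<close> of degree at
  most \<open>e\<close>, then \<open>A / (1 - s X)\<close> has this property with \<open>p = P(s)\<close>; the following
  lemmas build this up from linear factors \<open>P(s) = u s + v\<close>, with reversal
  \<open>u + v X\<close>.\<close>

definition geometric_from :: "'a::comm_ring_1 \<Rightarrow> nat \<Rightarrow> 'a \<Rightarrow> 'a fps \<Rightarrow> bool" where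
  "geometric_from s e p B \<longleftrightarrow> (\<forall>n. fps_nth B (e + n) = p * s ^ n)"

lemma geometric_from_geom: "geometric_from s 0 1 (geom_fps s)"
  by (simp add: geometric_from_def)

lemma geometric_from_mult:
  assumes "geometric_from s e p B"
  shows "geometric_from s (Suc e) ((u * s + v) * p) ((fps_const u + fps_const v * fps_X) * B)"
proof -
  have "fps_nth B (Suc (e + n)) = p * s ^ Suc n" "fps_nth B (e + n) = p * s ^ n" for n
    using assms unfolding geometric_from_def by (metis add_Suc_right)+
  then show ?thesis
    by (simp add: geometric_from_def distrib_right mult.assoc mult.left_commute[of p])
qed

lemma geometric_from_power:
  assumes "geometric_from s e p B"
  shows "geometric_from s (l + e) ((u * s + v) ^ l * p) ((fps_const u + fps_const v * fps_X) ^ l * B)"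
  using assms by (induction l) (auto dest: geometric_from_mult simp: mult.assoc)

lemma geometric_from_prod:
  assumes "geometric_from s e p B" "finite I"
  shows "geometric_from s (card I + e) ((\<Prod>i\<in>I. u i * s + v i) * p)
    ((\<Prod>i\<in>I. fps_const (u i) + fps_const (v i) * fps_X) * B)"
  using assms(2,1) by (induction I rule: finite_induct) (auto dest: geometric_from_mult simp: mult.assoc)

section \<open>The coefficients of the hypergeometric series\<close>

lemma pochhammer_plus_one_descending:
  fixes c :: "'a::comm_ring_1"
  shows "pochhammer (c + 1) m = (\<Prod>t<m. c + of_nat m - of_nat t)"
proof -
  have "pochhammer (c + 1) m = (\<Prod>t<m. c + 1 + of_nat (m - Suc t))"
    unfolding pochhammer_prod atLeast0LessThan by (subst prod.nat_diff_reindex) simp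
  also have "\<dots> = (\<Prod>t<m. c + of_nat m - of_nat t)"
    by (intro prod.cong refl) (simp add: of_nat_diff algebra_simps Suc_le_eq)
  finally show ?thesis .
qed

lemma pochhammer_uminus_descending:
  fixes c :: "'a::comm_ring_1"
  shows "pochhammer (- c) n = (- 1) ^ n * (\<Prod>t<n. c - of_nat t)"
proof -
  have "pochhammer (- c) n = (\<Prod>t<n. (- 1) * (c - of_nat t))"
    unfolding pochhammer_prod atLeast0LessThan by (intro prod.cong) auto
  then show ?thesis
    by (simp only: prod.distrib) simp
qed

lemma pochhammer_mult_numerator:
  fixes c :: "'a::comm_ring_1"
  assumes "m \<le> N"
  shows "pochhammer (c + 1) m * pochhammer (- c) (N - m)
    = (- 1) ^ (N - m) * (\<Prod>t<N. c + of_nat m - of_nat t)"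
proof -
  let ?h = "\<lambda>t. c + of_nat m - of_nat t"
  have "(\<Prod>t<N. ?h t) = (\<Prod>t<m. ?h t) * (\<Prod>t=m..<N. ?h t)"
    using assms by (metis atLeast0LessThan prod.atLeastLessThan_concat zero_le)
  also have "(\<Prod>t=m..<N. ?h t) = (\<Prod>t<N - m. ?h (t + m))"
    using prod.shift_bounds_nat_ivl[of ?h 0 m "N - m"] assms by (simp add: atLeast0LessThan)
  finally show ?thesis
    unfolding pochhammer_plus_one_descending pochhammer_uminus_descending
    by (simp add: mult_ac)
qed

lemma pochhammer_mult_denominator:
  fixes c :: "'a::comm_ring_1"
  assumes "m \<le> N"
  shows "pochhammer (c + 1) m * pochhammer (1 - c) (N - m)
    = (- 1) ^ (N - m) * (\<Prod>t\<in>{..N} - {m}. c + of_nat m - of_nat t)"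
proof -
  let ?h = "\<lambda>t. c + of_nat m - of_nat t"
  have split: "{..N} - {m} = {..<m} \<union> {Suc m..<Suc N}"
    using assms by auto
  have "(\<Prod>t\<in>{..N} - {m}. ?h t) = (\<Prod>t<m. ?h t) * (\<Prod>t=Suc m..<Suc N. ?h t)"
    unfolding split by (rule prod.union_disjoint) auto
  also have "(\<Prod>t=Suc m..<Suc N. ?h t) = (\<Prod>t<N - m. ?h (t + Suc m))"
    using prod.shift_bounds_nat_ivl[of ?h 0 "Suc m" "N - m"] assms by (simp add: atLeast0LessThan)
  also have "\<dots> = (\<Prod>t<N - m. (c - 1) - of_nat t)"
    by (intro prod.cong) (auto simp: algebra_simps)
  finally show ?thesis
    using pochhammer_uminus_descending[of "c - 1" "N - m"]
    unfolding pochhammer_plus_one_descending by (simp add: mult_ac)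
qed

lemma theta_power_single:
  "(theta ^^ k) (Poly_Mapping.single s F)
    = Poly_Mapping.single s (Abs_fps (\<lambda>n. (of_nat n + s) ^ k * fps_nth F n))"
proof (induction k)
  case (Suc k)
  have "fps_const s * F + fps_X * fps_deriv F = Abs_fps (\<lambda>n. (of_nat n + s) * fps_nth F n)"
    for F :: "complex fps"
  proof (rule fps_ext)
    show "(fps_const s * F + fps_X * fps_deriv F) $ n
        = Abs_fps (\<lambda>n. (of_nat n + s) * fps_nth F n) $ n" for n
      by (cases n) (simp_all add: algebra_simps)
  qed
  then show ?case
    unfolding funpow.simps comp_apply Suc.IH theta_single by (simp add: mult.assoc)
qed (simp add: Abs_fps_inverse fps_nth_inverse)

text \<open>The exponent of \<open>z\<close> in the \<open>m\<close>-th term of \<open>f\<^sub>i\<close>.\<close>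

definition node :: "(nat \<Rightarrow> complex) \<Rightarrow> nat \<times> nat \<Rightarrow> complex" where
  "node b = (\<lambda>(m, i). of_nat m + 1 - b i)"

lemma inj_on_node:
  assumes "\<And>i j. i \<in> {1..r} \<Longrightarrow> j \<in> {1..r} \<Longrightarrow> i \<noteq> j \<Longrightarrow> b i - b j \<notin> \<int>"
  shows "inj_on (node b) (T \<times> {1..r})"
proof (rule inj_onI, clarify)
  fix m i n j
  assume ij: "i \<in> {1..r}" "j \<in> {1..r}" and "node b (m, i) = node b (n, j)"
  then have eq: "b i - b j = of_int (int m - int n)"
    by (simp add: node_def algebra_simps)
  then have "i = j"
    using assms[OF ij] by (metis Ints_of_int)
  with eq show "m = n \<and> i = j" by simp
qed

text \<open>The combination of Pochhammer symbols as a residue. The factor \<open>dual_coeff r b i\<close>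
  accounts for the nodes \<open>(m, j)\<close> with \<open>j \<noteq> i\<close>, the Pochhammer symbols in the denominators for
  those \<open>(t, j)\<close> with \<open>t \<noteq> m\<close>.\<close>

lemma hyp_coeff_eq_node_weight:
  fixes a b :: "nat \<Rightarrow> complex"
  assumes i: "i \<in> {1..r}" and m: "m \<le> N"
  shows "dual_coeff r b i *
      ((\<Prod>j=1..r. pochhammer (a j + 1 - b i) m) / (\<Prod>j=1..r. pochhammer (b j + 1 - b i) m)) *
      ((\<Prod>j=1..r. pochhammer (b i - a j) (N - m)) /
       (\<Prod>j=1..r. pochhammer (b i + 1 - b j) (N - m)))
    = node_weight ({..N} \<times> {1..r}) (node b) (m, i) *
      (\<Prod>t<N. \<Prod>j=1..r. node b (m, i) + (a j - 1 - of_nat t))"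
proof -
  let ?s = "node b (m, i)"
  let ?e = "(- 1 :: complex) ^ (N - m)"
  have num: "(\<Prod>j=1..r. pochhammer (a j + 1 - b i) m) * (\<Prod>j=1..r. pochhammer (b i - a j) (N - m))
      = ?e ^ r * (\<Prod>t<N. \<Prod>j=1..r. ?s + (a j - 1 - of_nat t))"
  proof -
    have "pochhammer (a j + 1 - b i) m * pochhammer (b i - a j) (N - m)
        = ?e * (\<Prod>t<N. ?s + (a j - 1 - of_nat t))" for j
      using pochhammer_mult_numerator[OF m, of "a j - b i"]
      by (simp add: node_def algebra_simps)
    then show ?thesis
      by (subst prod.swap) (simp only: prod.distrib[symmetric], simp add: prod.distrib)
  qed
  have den: "(\<Prod>j=1..r. pochhammer (b j + 1 - b i) m) * (\<Prod>j=1..r. pochhammer (b i + 1 - b j) (N - m))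
      = ?e ^ r * (\<Prod>j=1..r. \<Prod>t\<in>{..N} - {m}. ?s - node b (t, j))"
  proof -
    have "pochhammer (b j + 1 - b i) m * pochhammer (b i + 1 - b j) (N - m)
        = ?e * (\<Prod>t\<in>{..N} - {m}. ?s - node b (t, j))" for j
      using pochhammer_mult_denominator[OF m, of "b j - b i"]
      by (simp add: node_def algebra_simps)
    then show ?thesis
      by (simp only: prod.distrib[symmetric]) (simp add: prod.distrib)
  qed
  have nodes: "{..N} \<times> {1..r} - {(m, i)}
      = ({..N} - {m}) \<times> {1..r} \<union> {m} \<times> ({1..r} - {i})"
    using m by auto
  have "(\<Prod>q\<in>{..N} \<times> {1..r} - {(m, i)}. ?s - node b q)
      = (\<Prod>q\<in>({..N} - {m}) \<times> {1..r}. ?s - node b q) * (\<Prod>q\<in>{m} \<times> ({1..r} - {i}). ?s - node b q)"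
    unfolding nodes by (rule prod.union_disjoint) auto
  also have "(\<Prod>q\<in>({..N} - {m}) \<times> {1..r}. ?s - node b q)
      = (\<Prod>j=1..r. \<Prod>t\<in>{..N} - {m}. ?s - node b (t, j))"
    by (subst prod.swap) (simp add: prod.cartesian_product case_prod_beta)
  also have "(\<Prod>q\<in>{m} \<times> ({1..r} - {i}). ?s - node b q) = (\<Prod>j\<in>{1..r} - {i}. b j - b i)"
    by (rule prod.reindex_bij_witness[of _ "Pair m" snd]) (auto simp: node_def)
  finally have weight: "node_weight ({..N} \<times> {1..r}) (node b) (m, i)
      = dual_coeff r b i / (\<Prod>j=1..r. \<Prod>t\<in>{..N} - {m}. ?s - node b (t, j))"
    by (simp add: node_weight_def dual_coeff_def prod_dividef)
  have ratio: "c * (p / q) * (p' / q') = c * ((p * p') / (q * q'))" for c p q p' q' :: complex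
    by simp
  show ?thesis
    unfolding ratio num den weight by simp
qed

section \<open>The bilinear sums\<close>

text \<open>The expansion at infinity of \<open>x\<^sup>r \<Prod>\<^sub>j (\<Prod>\<^sub>t (x + a\<^sub>j - 1 - t) / \<Prod>\<^sub>m (x - (m + 1 - b\<^sub>j)))\<close>,
  where \<open>0 \<le> t < N\<close> and \<open>0 \<le> m \<le> N\<close>, as a power series in \<open>X = 1/x\<close>.\<close>

definition node_fps ::
    "nat \<Rightarrow> (nat \<Rightarrow> complex) \<Rightarrow> (nat \<Rightarrow> complex) \<Rightarrow> nat \<Rightarrow> complex fps" where
  "node_fps r a b N =
     (\<Prod>t<N. \<Prod>j=1..r. fps_const 1 + fps_const (a j - 1 - of_nat t) * fps_X) *
     (\<Prod>m\<le>N. \<Prod>j=1..r. geom_fps (of_nat m + 1 - b j))"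

lemma fps_prod_nth_0: "fps_nth (\<Prod>i\<in>I. U i) 0 = (\<Prod>i\<in>I. fps_nth (U i) 0)"
  by (induction I rule: infinite_finite_induct) simp_all

lemma node_fps_nth_0: "fps_nth (node_fps r a b N) 0 = 1"
  by (simp add: node_fps_def fps_prod_nth_0)

lemma node_fps_poly_fps_seq:
  assumes "subring K" and a: "\<And>j. j \<in> {1..r} \<Longrightarrow> a j \<in> K" and b: "\<And>j. j \<in> {1..r} \<Longrightarrow> b j \<in> K"
  shows "node_fps r a b \<in> subring.poly_fps_seqs K"
proof -
  interpret subring K by fact
  define V where "V N = (\<Prod>j=1..r. fps_const 1 + fps_const (a j - 1 - of_nat N) * fps_X) *
     (\<Prod>j=1..r. geom_fps (of_nat N + (2 - b j)))" for N
  have lin: "(\<lambda>N. of_nat N + c) \<in> poly_seqs" "(\<lambda>N. c - of_nat N) \<in> poly_seqs" if "c \<in> K" for c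
    using add_poly_seq[OF of_nat_poly_seq const_poly_seq[OF that]]
      add_poly_seq[OF const_poly_seq[OF that]
        mult_poly_seq[OF const_poly_seq[OF uminus_mem[OF one_mem]] of_nat_poly_seq]]
    by simp_all
  have two: "2 \<in> K"
    using add_mem[OF one_mem one_mem] by simp
  show ?thesis
  proof (rule partial_product_poly_fps_seq)
    show "V \<in> poly_fps_seqs"
      unfolding V_def using a b
      by (intro mult_poly_fps_seq prod_poly_fps_seq linear_poly_fps_seq geom_poly_fps_seq lin
          diff_mem one_mem two)
    show "fps_nth (V N) 0 = 1" for N
      by (simp add: V_def fps_prod_nth_0)
    show "node_fps r a b (Suc N) = node_fps r a b N * V N" for N
      by (simp add: node_fps_def V_def algebra_simps)
    have "(\<lambda>_::nat. node_fps r a b 0) \<in> poly_fps_seqs"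
      unfolding node_fps_def using b
      by (simp, intro prod_poly_fps_seq geom_poly_fps_seq const_poly_seq diff_mem one_mem) auto
    then show "fps_nth (node_fps r a b 0) p \<in> K" for p
      by (auto simp: poly_fps_seqs_def dest: poly_seq_0_mem)
  qed
qed

text \<open>The numerator has degree \<open>k + l + r N\<close>, and there are \<open>r (N + 1)\<close> nodes, so the coefficient
  of \<open>1/x\<close> at infinity sits at position \<open>k + l - (r - 1)\<close>. The linear factor
  \<open>-1 + N X\<close> is the reversal of \<open>N - x\<close>.\<close>

lemma bilinear_sum_coeff:
  fixes a b :: "nat \<Rightarrow> complex"
  assumes "r \<ge> 1"
    and "\<And>i j. i \<in> {1..r} \<Longrightarrow> j \<in> {1..r} \<Longrightarrow> i \<noteq> j \<Longrightarrow> b i - b j \<notin> \<int>"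
  defines "A \<equiv> \<lambda>i n. (\<Prod>j=1..r. pochhammer (a j + 1 - b i) n) / (\<Prod>j=1..r. pochhammer (b j + 1 - b i) n)"
    and "B \<equiv> \<lambda>i n. (\<Prod>j=1..r. pochhammer (b i - a j) n) / (\<Prod>j=1..r. pochhammer (b i + 1 - b j) n)"
  shows "(\<Sum>i=1..r. dual_coeff r b i * (\<Sum>m\<le>N. ((of_nat m + (1 - b i)) ^ k * A i m) *
        ((of_nat (N - m) + (b i - 1)) ^ l * B i (N - m))))
    = (if k + l < r - 1 then 0
       else fps_nth ((fps_const (- 1) + fps_const (of_nat N) * fps_X) ^ l * node_fps r a b N)
              (k + l - (r - 1)))"
proof -
  define I where "I = {..N} \<times> {1..r}"
  define P where "P = (\<Prod>t<N. \<Prod>j=1..r. fps_const 1 + fps_const (a j - 1 - of_nat t) * fps_X)"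
  define p where "p s = (\<Prod>t<N. \<Prod>j=1..r. s + (a j - 1 - of_nat t))" for s
  define L where "L = (fps_const (- 1) + fps_const (of_nat N :: complex) * fps_X) ^ l"
  let ?e = "l + N * r + k"
  have I: "finite I" "I \<noteq> {}" "inj_on (node b) I" "card I - 1 = N * r + (r - 1)"
    using assms(1) inj_on_node[OF assms(2)] by (auto simp: I_def)
  \<comment> \<open>The factor \<open>s\<^sup>k\<close> needs no reversal: it is read off \<open>k\<close> places further on.\<close>
  have geom: "geometric_from s (l + N * r) ((of_nat N - s) ^ l * p s) (L * (P * geom_fps s))" for s
  proof -
    have "geometric_from s (N * r) (p s) (P * geom_fps s)"
      using geometric_from_prod[OF geometric_from_geom, of "{..<N} \<times> {1..r}" s "\<lambda>_. 1"
          "\<lambda>(t, j). a j - 1 - of_nat t"]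
      by (simp add: p_def P_def prod.cartesian_product case_prod_beta)
    from geometric_from_power[OF this, of l "- 1" "of_nat N"] show ?thesis
      by (simp add: L_def)
  qed
  have "(\<Sum>i=1..r. dual_coeff r b i * (\<Sum>m\<le>N. ((of_nat m + (1 - b i)) ^ k * A i m) *
        ((of_nat (N - m) + (b i - 1)) ^ l * B i (N - m))))
      = (\<Sum>m\<le>N. \<Sum>i=1..r. dual_coeff r b i * A i m * B i (N - m) *
          ((of_nat m + (1 - b i)) ^ k * (of_nat (N - m) + (b i - 1)) ^ l))"
    unfolding sum_distrib_left by (subst sum.swap) (simp add: mult_ac)
  also have "\<dots> = (\<Sum>m\<le>N. \<Sum>i=1..r. node_weight I (node b) (m, i) *
      (((of_nat N - node b (m, i)) ^ l * p (node b (m, i))) * node b (m, i) ^ k))"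
  proof (intro sum.cong refl)
    fix m i assume "m \<in> {..N}" and i: "i \<in> {1..r}"
    then have m: "m \<le> N" by simp
    have s: "of_nat m + (1 - b i) = node b (m, i)"
      "of_nat (N - m) + (b i - 1) = of_nat N - node b (m, i)"
      using m by (simp_all add: node_def of_nat_diff)
    show "dual_coeff r b i * A i m * B i (N - m) *
          ((of_nat m + (1 - b i)) ^ k * (of_nat (N - m) + (b i - 1)) ^ l)
        = node_weight I (node b) (m, i) *
          (((of_nat N - node b (m, i)) ^ l * p (node b (m, i))) * node b (m, i) ^ k)"
      unfolding A_def B_def hyp_coeff_eq_node_weight[OF i m] s p_def I_def by (simp only: mult_ac)
  qed
  also have "\<dots> = (\<Sum>q\<in>I. node_weight I (node b) q *
      (((of_nat N - node b q) ^ l * p (node b q)) * node b q ^ k))"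
    by (simp add: I_def sum.cartesian_product case_prod_beta)
  also have "\<dots> = (\<Sum>q\<in>I. node_weight I (node b) q * fps_nth (L * (P * geom_fps (node b q))) ?e)"
    using geom by (simp add: geometric_from_def)
  also have "\<dots> = fps_nth (L * P * (\<Sum>q\<in>I. fps_const (node_weight I (node b) q) * geom_fps (node b q))) ?e"
    by (simp add: sum_distrib_left fps_sum_nth mult.left_commute[of _ "fps_const _"] mult.assoc)
  also have "\<dots> = fps_nth (fps_X ^ (N * r + (r - 1)) * (L * node_fps r a b N)) ?e"
    unfolding sum_node_weight_geom[OF I(1-3)] I(4)
    by (simp add: node_fps_def P_def I_def node_def prod.cartesian_product case_prod_beta mult_ac)
  also have "\<dots> = (if k + l < r - 1 then 0 else fps_nth (L * node_fps r a b N) (k + l - (r - 1)))"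
    by (simp add: fps_X_power_mult_nth add.commute add.left_commute)
  finally show ?thesis
    by (simp only: L_def)
qed

lemma subring_param_field: "subring (param_field r a b)"
  and param_field_contains:
    "i \<in> {1..r} \<Longrightarrow> a i \<in> param_field r a b" "i \<in> {1..r} \<Longrightarrow> b i \<in> param_field r a b"
proof -
  have "is_subfield (param_field r a b)"
    unfolding param_field_def by (rule hull_in) (auto simp: is_subfield_def)
  then show "subring (param_field r a b)"
    by (auto simp: is_subfield_def subring_def)
  have "a ` {1..r} \<union> b ` {1..r} \<subseteq> param_field r a b"
    unfolding param_field_def by (rule hull_subset)
  then show "i \<in> {1..r} \<Longrightarrow> a i \<in> param_field r a b" "i \<in> {1..r} \<Longrightarrow> b i \<in> param_field r a b"
    by auto
qed

theorem theorem1p1: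
  fixes r :: nat and a b :: "nat \<Rightarrow> complex"
  assumes "r \<ge> 2"
    and "b r = 1"
    and "\<And>i j. i \<in> {1..r} \<Longrightarrow> j \<in> {1..r} \<Longrightarrow> i \<noteq> j \<Longrightarrow> b i - b j \<notin> \<int>"
  shows "\<forall>k\<in>{0..r-1}. \<forall>l\<in>{0..r-1}.
    \<exists>M\<in>rational_expansions (param_field r a b).
      (\<Sum>i=1..r. fps_embed (fps_const (dual_coeff r b i)) *
         (theta ^^ k) (hyp_f r a b i) * (theta ^^ l) (hyp_g r a b i)) = fps_embed M \<and>
      (k + l \<le> r - 2 \<longrightarrow> M = 0) \<and>
      (k + l = r - 1 \<longrightarrow> M = fps_const ((-1) ^ l) / (1 - fps_X))"
proof (intro ballI)
  fix k l
  let ?K = "param_field r a b"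
  interpret subring ?K by (rule subring_param_field)
  define A where "A i n = (\<Prod>j=1..r. pochhammer (a j + 1 - b i) n) /
    (\<Prod>j=1..r. pochhammer (b j + 1 - b i) n)" for i n
  define B where "B i n = (\<Prod>j=1..r. pochhammer (b i - a j) n) /
    (\<Prod>j=1..r. pochhammer (b i + 1 - b j) n)" for i n
  define c where "c N = (if k + l < r - 1 then 0
      else fps_nth ((fps_const (- 1) + fps_const (of_nat N) * fps_X) ^ l * node_fps r a b N)
             (k + l - (r - 1)))" for N
  have "(\<lambda>N. (fps_const (- 1) + fps_const (of_nat N) * fps_X) ^ l * node_fps r a b N)
      \<in> poly_fps_seqs"
    using param_field_contains
    by (intro mult_poly_fps_seq power_poly_fps_seq linear_poly_fps_seq node_fps_poly_fps_seq
        of_nat_poly_seq uminus_mem one_mem subring_param_field) auto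
  then have "c \<in> poly_seqs"
    unfolding c_def by (cases "k + l < r - 1") (simp_all add: poly_fps_seqs_def poly_seqs.zero)
  then have rational: "Abs_fps c \<in> rational_expansions ?K"
    by (rule poly_seq_rational_expansion[OF subring_param_field])
  define F where "F i = Abs_fps (\<lambda>n. (of_nat n + (1 - b i)) ^ k * A i n)" for i
  define G where "G i = Abs_fps (\<lambda>n. (of_nat n + (b i - 1)) ^ l * B i n)" for i
  have f: "(theta ^^ k) (hyp_f r a b i) = Poly_Mapping.single (1 - b i) (F i)" for i
    by (simp add: hyp_f_def zpow_def fps_embed_def mult_single theta_power_single F_def A_def)
  have g: "(theta ^^ l) (hyp_g r a b i) = Poly_Mapping.single (b i - 1) (G i)" for i
    by (simp add: hyp_g_def zpow_def fps_embed_def mult_single theta_power_single G_def B_def)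
  have "(\<Sum>i=1..r. fps_const (dual_coeff r b i) * (F i * G i)) = Abs_fps c"
  proof (rule fps_ext)
    fix N
    have "fps_nth (\<Sum>i=1..r. fps_const (dual_coeff r b i) * (F i * G i)) N
        = (\<Sum>i=1..r. dual_coeff r b i * (\<Sum>m\<le>N. ((of_nat m + (1 - b i)) ^ k * A i m) *
            ((of_nat (N - m) + (b i - 1)) ^ l * B i (N - m))))"
      unfolding fps_sum_nth fps_mult_left_const_nth
      by (simp only: fps_mult_nth F_def G_def fps_nth_Abs_fps atLeast0AtMost)
    also have "\<dots> = c N"
      unfolding A_def B_def c_def using assms(1) by (intro bilinear_sum_coeff assms(3)) auto
    finally show "fps_nth (\<Sum>i=1..r. fps_const (dual_coeff r b i) * (F i * G i)) N
        = fps_nth (Abs_fps c) N"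
      by simp
  qed
  moreover have "(\<Sum>i=1..r. fps_embed (fps_const (dual_coeff r b i)) *
      (theta ^^ k) (hyp_f r a b i) * (theta ^^ l) (hyp_g r a b i))
      = (\<Sum>i=1..r. fps_embed (fps_const (dual_coeff r b i) * (F i * G i)))"
    by (simp add: f g fps_embed_def mult_single mult.assoc)
  moreover have "(\<Sum>i\<in>J. fps_embed (H i)) = fps_embed (\<Sum>i\<in>J. H i)" for J and H :: "nat \<Rightarrow> complex fps"
    by (induction J rule: infinite_finite_induct) (simp_all add: fps_embed_def single_add)
  ultimately have sum: "(\<Sum>i=1..r. fps_embed (fps_const (dual_coeff r b i)) *
      (theta ^^ k) (hyp_f r a b i) * (theta ^^ l) (hyp_g r a b i)) = fps_embed (Abs_fps c)"
    by simp
  have "Abs_fps c = 0" if "k + l \<le> r - 2"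
    using that assms(1) by (simp add: c_def fps_eq_iff)
  moreover have "Abs_fps c = fps_const ((-1) ^ l) / (1 - fps_X)" if "k + l = r - 1"
  proof -
    have "c N = (- 1) ^ l" for N
      using that by (simp add: c_def node_fps_nth_0 fps_power_zeroth)
    then have "Abs_fps c = fps_const ((- 1) ^ l) * geom_fps 1"
      by (simp add: fps_eq_iff)
    also have "geom_fps 1 = inverse (1 - fps_X :: complex fps)"
      using geom_fps_inverse[of "1 :: complex"] by (intro fps_inverse_unique[symmetric]) simp
    finally show ?thesis
      by (simp add: fps_divide_unit)
  qed
  ultimately show "\<exists>M\<in>rational_expansions ?K.
      (\<Sum>i=1..r. fps_embed (fps_const (dual_coeff r b i)) *
         (theta ^^ k) (hyp_f r a b i) * (theta ^^ l) (hyp_g r a b i)) = fps_embed M \<and>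
      (k + l \<le> r - 2 \<longrightarrow> M = 0) \<and>
      (k + l = r - 1 \<longrightarrow> M = fps_const ((-1) ^ l) / (1 - fps_X))"
    using rational sum by blast
qed

end
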